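(* For every $\gamma\ge1$, isentropic Navier–Stokes shocks are stable for Mach number $M$ sufficiently large (equivalently, for $v_+$ sufficiently small): there exists $v_*=v_*(\gamma)\in(0,1)$ such that for every $0<v_+<v_*$ the shock profile with parameter $v_+$ is stable.
   Context: The isentropic compressible Navier–Stokes equations with $\gamma$-law pressure, in Lagrangian coordinates, are $v_t-u_x=0$, $u_t+(a_0v^{-\gamma})_x=(u_x/v)_x$ with $a_0>0$, $\gamma\ge1$. For a traveling wave $(\hat v,\hat u)(x-st)$, passing to the moving frame and rescaling $(x,t,v,u)\to(-\varepsilon sx,\varepsilon s^2t,v/\varepsilon,-u/(\varepsilon s))$, with $\varepsilon>0$ chosen so that the endstates satisfy $0<v_+<v_-=1$, one obtains stationary solutions of $$v_t+v_x-u_x=0,\qquad u_t+u_x+(av^{-\gamma})_x=\Big(\frac{u_x}{v}\Big)_x,$$ where necessarily $a=v_+^{\gamma}\frac{1-v_+}{1-v_+^{\gamma}}$. The shock profile with parameter $v_+\in(0,1)$ is the stationary solution $(\hat v,\hat u)(x)$ with $\hat v$ the (unique up to translation) monotone decreasing solution of $v'=v(v-1+a(v^{-\gamma}-1))$, $\hat v(-\infty)=1$, $\hat v(+\infty)=v_+$, and $\hat u'=\hat v'$. Its Mach number is $M=(\gamma a)^{-1/2}$, and $M\to\infty$ corresponds to $v_+\to0$. With $h(\hat v)=-\hat v^{\gamma+1}+a(\gamma-1)+(a+1)\hat v^{\gamma}$, the linearized eigenvalue problem about the profile is $$\lambda v+v'-u'=0,\qquad \lambda u+u'-\Big(\frac{h(\hat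 v)}{\hat v^{\gamma+1}}v\Big)'=\Big(\frac{u'}{\hat v}\Big)'.$$ The shock is called stable if it is spectrally stable: there is no $\lambda\ne0$ with $\operatorname{Re}\lambda\ge0$ for which this problem has a nontrivial solution $(v,u)$ decaying as $x\to\pm\infty$. *)

theory Defs
  imports "HOL-Analysis.Analysis"
begin

text \<open>Throughout, \<open>\<gamma>\<close> is the adiabatic exponent and \<open>vp\<close> the right endstate of the profile;
  the left endstate is normalised to 1. Real powers are only used with a positive base.\<close>

definition pressure_coeff :: "real \<Rightarrow> real \<Rightarrow> real" where
  "pressure_coeff \<gamma> vp = vp powr \<gamma> * ((1 - vp) / (1 - vp powr \<gamma>))"

definition mach_number :: "real \<Rightarrow> real \<Rightarrow> real" where
  "mach_number \<gamma> vp = (\<gamma> * pressure_coeff \<gamma> vp) powr (- 1 / 2)"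

text \<open>The velocity component is determined by the specific volume only up to an additive constant,
  and the specific volume only up to translation, so the profile is a predicate.\<close>

definition shock_profile ::
    "real \<Rightarrow> real \<Rightarrow> (real \<Rightarrow> real) \<Rightarrow> (real \<Rightarrow> real) \<Rightarrow> bool" where
  "shock_profile \<gamma> vp vhat uhat \<longleftrightarrow>
     (\<forall>x. (vhat has_real_derivative
             vhat x * (vhat x - 1 + pressure_coeff \<gamma> vp * (vhat x powr (- \<gamma>) - 1))) (at x)) \<and>
     antimono vhat \<and>
     (vhat \<longlongrightarrow> 1) at_bot \<and>
     (vhat \<longlongrightarrow> vp) at_top \<and>
     (\<forall>x. (uhat has_real_derivative deriv vhat x) (at x))"

definition h_coeff :: "real \<Rightarrow> real \<Rightarrow> real \<Rightarrow> real" where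
  "h_coeff \<gamma> vp y =
     - (y powr (\<gamma> + 1)) + pressure_coeff \<gamma> vp * (\<gamma> - 1) + (pressure_coeff \<gamma> vp + 1) * y powr \<gamma>"

text \<open>Classical solutions of the linearised eigenvalue problem about a profile.
  The witnesses \<open>v'\<close>, \<open>u'\<close>, \<open>p'\<close>, \<open>q'\<close> are the derivatives occurring in the two equations.
  The equations do not involve the velocity component of the profile.\<close>

definition eigenvalue_solution ::
    "real \<Rightarrow> real \<Rightarrow> (real \<Rightarrow> real) \<Rightarrow> complex \<Rightarrow> (real \<Rightarrow> complex) \<Rightarrow> (real \<Rightarrow> complex) \<Rightarrow> bool" where
  "eigenvalue_solution \<gamma> vp vhat lam v u \<longleftrightarrow>
     (\<exists>v' u' p' q'. \<forall>x.
        (v has_vector_derivative v' x) (at x) \<and>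
        (u has_vector_derivative u' x) (at x) \<and>
        ((\<lambda>y. complex_of_real (h_coeff \<gamma> vp (vhat y) / vhat y powr (\<gamma> + 1)) * v y)
           has_vector_derivative p' x) (at x) \<and>
        ((\<lambda>y. u' y / complex_of_real (vhat y)) has_vector_derivative q' x) (at x) \<and>
        lam * v x + v' x - u' x = 0 \<and>
        lam * u x + u' x - p' x = q' x)"

definition spectrally_stable :: "real \<Rightarrow> real \<Rightarrow> (real \<Rightarrow> real) \<Rightarrow> bool" where
  "spectrally_stable \<gamma> vp vhat \<longleftrightarrow>
     \<not> (\<exists>lam v u. lam \<noteq> 0 \<and> Re lam \<ge> 0 \<and>
          eigenvalue_solution \<gamma> vp vhat lam v u \<and>
          (\<exists>x. v x \<noteq> 0 \<or> u x \<noteq> 0) \<and>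
          (v \<longlongrightarrow> 0) at_bot \<and> (v \<longlongrightarrow> 0) at_top \<and>
          (u \<longlongrightarrow> 0) at_bot \<and> (u \<longlongrightarrow> 0) at_top)"

end

theory Submission
  imports Defs
begin

text \<open>
  Spectral stability comes from an energy identity in the right variables. Write
  \<open>p(v) = a v\<^sup>-\<^sup>\<gamma>\<close> for the pressure and \<open>b = - p'(vhat) > 0\<close>. Since
  \<open>u\<^sub>x / v = (\<partial>\<^sub>t + \<partial>\<^sub>x) ln v\<close>, the effective velocity \<open>w = u - (ln v)\<^sub>x\<close> satisfies
  \<open>w\<^sub>t + w\<^sub>x + p(v)\<^sub>x = 0\<close>: all the dissipation moves to the equation for \<open>v\<close>.
  Linearise about the profile and integrate once in space, which is possible because
  \<open>\<lambda> \<noteq> 0\<close>. The antiderivatives \<open>V\<close> and \<open>W\<close> of \<open>v\<close> and \<open>w\<close> satisfy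
  \<open>\<lambda> W + W' = b V'\<close> and \<open>\<lambda> V + V' - W' = (V' / vhat)'\<close>.
  Test the first equation with \<open>W / b\<close> and the second with \<open>V\<close>. The coupling terms
  combine into an exact derivative, and after integration the real part is
  \<open>Re \<lambda> \<integral> (|W|\<^sup>2 / b + |V|\<^sup>2) - (1/2) \<integral> (1/b)' |W|\<^sup>2 + \<integral> |V'|\<^sup>2 / vhat = 0\<close>.
  As the profile decreases and the pressure is convex, \<open>b\<close> increases, so every term is
  nonnegative. Hence \<open>V' = v = 0\<close>, and then \<open>V = 0\<close> and \<open>u = v + \<lambda> V = 0\<close>.

  Only decay of \<open>v\<close> and \<open>u\<close> at infinity is given, not integrability. The identity is
  therefore used in differential form: an energy with nonpositive derivative that tends to 0 at
  both ends vanishes identically (\<open>effective_system_trivial\<close>). This requires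
  \<open>W \<rightarrow> 0\<close>, which involves a derivative of \<open>v\<close> and is recovered from the equations by
  a Barbalat-type argument (\<open>slowly_varying_derivative_tendsto_0\<close>).

  This gives stability for each \<open>vp\<close> in \<open>(0,1)\<close>, hence at every Mach number
  (\<open>shock_profile_spectrally_stable\<close>).
\<close>

section \<open>Decay of a slowly varying derivative\<close>

lemma eventually_unit_window:
  fixes P :: "real \<Rightarrow> bool"
  assumes "F = at_top \<or> F = at_bot" and "eventually P F"
  shows "eventually (\<lambda>x. \<forall>t\<in>{x..x+1}. P t) F"
  using assms(1)
proof
  assume F: "F = at_top"
  then obtain N where "\<forall>t\<ge>N. P t"
    using assms(2) by (auto simp: eventually_at_top_linorder)
  then have "\<forall>x\<ge>N. \<forall>t\<in>{x..x+1}. P t" by auto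
  then show ?thesis unfolding F eventually_at_top_linorder by blast
next
  assume F: "F = at_bot"
  then obtain N where "\<forall>t\<le>N. P t"
    using assms(2) by (auto simp: eventually_at_bot_linorder)
  then have "\<forall>x\<le>N-1. \<forall>t\<in>{x..x+1}. P t" by auto
  then show ?thesis unfolding F eventually_at_bot_linorder by blast
qed

lemma unit_increment_bound:
  fixes f :: "real \<Rightarrow> 'a::real_normed_vector"
  assumes "\<And>t. (f has_vector_derivative f' t) (at t)"
    and "\<And>t. t \<in> {x..x+1} \<Longrightarrow> norm (f' t - k) \<le> e"
    and "t \<in> {x..x+1}"
  shows "norm (f t - f x - (t - x) *\<^sub>R k) \<le> e"
proof -
  let ?g = "\<lambda>s. f s - s *\<^sub>R k"
  have der: "(?g has_derivative (\<lambda>h. h *\<^sub>R (f' s - k))) (at s within {x..x+1})" for s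
  proof -
    have "(?g has_vector_derivative (f' s - 1 *\<^sub>R k)) (at s)"
      by (rule has_vector_derivative_diff[OF assms(1)]) (auto intro!: derivative_eq_intros)
    then show ?thesis
      by (auto simp: has_vector_derivative_def intro: has_derivative_at_withinI)
  qed
  have "norm (?g t - ?g x) \<le> e * norm (t - x)"
  proof (rule differentiable_bound[OF _ der])
    fix s assume "s \<in> {x..x+1}"
    then have "norm (f' s - k) \<le> e" using assms(2) by blast
    then show "onorm (\<lambda>h. h *\<^sub>R (f' s - k)) \<le> e"
      by (intro onorm_le) (simp add: mult.commute[of _ "norm (f' s - k)"] mult_right_mono)
  qed (use assms(3) in auto)
  also have "\<dots> \<le> e * 1"
  proof (rule mult_left_mono)
    show "0 \<le> e" using assms(2)[OF assms(3)] norm_ge_zero order_trans by blast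
  qed (use assms(3) in auto)
  finally show ?thesis by (simp add: algebra_simps)
qed

text \<open>A variant of Barbalat's lemma: on an interval of length 1 the function \<open>S\<close> is nearly
  constant, so the increment of \<open>f\<close> over that interval is close to \<open>S\<close>; but this increment
  tends to 0 together with \<open>f\<close>.\<close>

lemma slowly_varying_derivative_tendsto_0:
  fixes f S :: "real \<Rightarrow> 'a::real_normed_vector"
  assumes F: "F = at_top \<or> F = at_bot"
    and df: "\<And>t. (f has_vector_derivative f' t) (at t)"
    and dS: "\<And>t. (S has_vector_derivative S' t) (at t)"
    and f0: "(f \<longlongrightarrow> 0) F" and S'0: "(S' \<longlongrightarrow> 0) F"
    and near: "((\<lambda>t. f' t - S t) \<longlongrightarrow> 0) F"
  shows "(S \<longlongrightarrow> 0) F"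
proof (rule tendstoI)
  fix e :: real assume "e > 0"
  define d where "d = e / 8"
  have "d > 0" using \<open>e > 0\<close> by (simp add: d_def)
  have "eventually (\<lambda>t. norm (f t) < d \<and> norm (S' t) < d \<and> norm (f' t - S t) < d) F"
    using tendstoD[OF f0 \<open>d > 0\<close>] tendstoD[OF S'0 \<open>d > 0\<close>] tendstoD[OF near \<open>d > 0\<close>]
    by eventually_elim simp
  from eventually_unit_window[OF F this]
  show "eventually (\<lambda>x. dist (S x) 0 < e) F"
  proof eventually_elim
    case (elim x)
    have S: "norm (S t - S x) \<le> d" if "t \<in> {x..x+1}" for t
      using unit_increment_bound[OF dS, of x 0 d t] elim that by force
    have "norm (f' t - S x) \<le> 2 * d" if t: "t \<in> {x..x+1}" for t
    proof -
      have "norm (f' t - S x) \<le> norm (f' t - S t) + norm (S t - S x)"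
        by (metis diff_add_cancel add_diff_eq norm_triangle_ineq)
      then show ?thesis using S[OF t] elim t by force
    qed
    from unit_increment_bound[of f f' x "S x" "2 * d" "x+1", OF df this]
    have "norm (f (x+1) - f x - S x) \<le> 2 * d" by simp
    moreover have "norm (S x) \<le> norm (f (x+1) - f x - S x) + norm (f (x+1)) + norm (f x)"
      by norm
    moreover have "norm (f (x+1)) < d" "norm (f x) < d" using elim by auto
    ultimately show ?case using \<open>d > 0\<close> by (simp add: d_def)
  qed
qed

section \<open>The energy estimate\<close>

lemma antimono_between_limits:
  fixes f :: "real \<Rightarrow> real"
  assumes "antimono f" "(f \<longlongrightarrow> l) at_bot" "(f \<longlongrightarrow> m) at_top"
  shows "m \<le> f x" "f x \<le> l"
proof -
  have "eventually (\<lambda>y. f y \<le> f x) at_top"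
    using eventually_ge_at_top[of x] by eventually_elim (use assms(1) in \<open>auto simp: antimono_def\<close>)
  then show "m \<le> f x" using assms(3) by (simp add: tendsto_upperbound)
  have "eventually (\<lambda>y. f y \<ge> f x) at_bot"
    using eventually_le_at_bot[of x] by eventually_elim (use assms(1) in \<open>auto simp: antimono_def\<close>)
  then show "f x \<le> l" using assms(2) by (simp add: tendsto_lowerbound)
qed

text \<open>The integrated system for \<open>V\<close>, \<open>W\<close> and \<open>z = V' / c\<close>, with \<open>c\<close> standing for the
  profile and \<open>b\<close> for minus the pressure derivative along it. The sign condition
  \<open>b' \<ge> 0\<close> makes the energy decrease; the bounds on \<open>b\<close> and \<open>b'\<close> serve to show that
  the energy vanishes at infinity.\<close>

lemma effective_system_trivial:
  fixes V W z :: "real \<Rightarrow> complex" and b b' c :: "real \<Rightarrow> real" and lam :: complex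
  assumes lam: "lam \<noteq> 0" "Re lam \<ge> 0"
    and V: "\<And>x. (V has_vector_derivative c x *\<^sub>R z x) (at x)"
    and W: "\<And>x. (W has_vector_derivative (b x * c x) *\<^sub>R z x - lam * W x) (at x)"
    and z: "\<And>x. (z has_vector_derivative lam * (V x + W x) + ((1 - b x) * c x) *\<^sub>R z x) (at x)"
    and b: "\<And>x. (b has_real_derivative b' x) (at x)"
    and c_pos: "\<And>x. c x > 0" and b_lower: "b0 > 0" "\<And>x. b0 \<le> b x" and b'_nonneg: "\<And>x. b' x \<ge> 0"
    and b_upper: "\<And>x. b x \<le> b1" and b'_upper: "\<And>x. b' x \<le> b2"
    and V_bot: "(V \<longlongrightarrow> 0) at_bot" and V_top: "(V \<longlongrightarrow> 0) at_top"
    and z_bot: "(z \<longlongrightarrow> 0) at_bot" and z_top: "(z \<longlongrightarrow> 0) at_top"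
  shows "z x = 0"
proof -
  have b_pos: "b x > 0" for x using b_lower(1) b_lower(2)[of x] by linarith
  have bnd: "((\<lambda>x. g x *\<^sub>R f x) \<longlongrightarrow> 0) F"
    if "(f \<longlongrightarrow> 0) F" "\<And>x. 0 \<le> g x" "\<And>x. g x \<le> B" for f :: "real \<Rightarrow> complex" and g B F
  proof -
    have "((\<lambda>x. B * norm (f x)) \<longlongrightarrow> 0) F"
      using tendsto_mult[OF tendsto_const[of B] tendsto_norm[OF that(1)]] by simp
    then show ?thesis
      by (rule Lim_null_comparison[rotated])
         (use that(2,3) in \<open>auto intro!: always_eventually mult_right_mono\<close>)
  qed
  have W0: "(W \<longlongrightarrow> 0) F"
    if F: "F = at_top \<or> F = at_bot" and V0: "(V \<longlongrightarrow> 0) F" and z0: "(z \<longlongrightarrow> 0) F" for F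
  proof -
    \<comment> \<open>The terms in \<open>b V'\<close> cancel in \<open>(W + z - V)' = \<lambda> V\<close>, so this combination varies
      slowly. On the other hand \<open>z - V + b V\<close> tends to 0, and its derivative is
      \<open>\<lambda> (V + W) + b' V\<close>, which differs from \<open>\<lambda> (W + z - V)\<close> only by decaying terms.\<close>
    define S where "S = (\<lambda>x. lam * (W x + z x - V x))"
    have bV: "((\<lambda>x. b x *\<^sub>R V x) \<longlongrightarrow> 0) F" 
      by (rule bnd[OF V0 _ b_upper]) (simp add: b_pos less_imp_le)
    have b'V: "((\<lambda>x. b' x *\<^sub>R V x) \<longlongrightarrow> 0) F" 
      by (rule bnd[OF V0 b'_nonneg b'_upper])
    have "(S \<longlongrightarrow> 0) F"
    proof (rule slowly_varying_derivative_tendsto_0[OF F])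
      show "((\<lambda>x. z x - V x + b x *\<^sub>R V x) has_vector_derivative
              lam * (V t + W t) + b' t *\<^sub>R V t) (at t)" for t
        by (rule has_vector_derivative_eq_rhs,
            rule has_vector_derivative_add[OF has_vector_derivative_diff[OF z V]
              has_vector_derivative_scaleR[OF b V]])
           (simp add: algebra_simps)
      have "((\<lambda>x. W x + z x - V x) has_vector_derivative lam * V t) (at t)" for t
        by (rule has_vector_derivative_eq_rhs,
            rule has_vector_derivative_diff[OF has_vector_derivative_add[OF W z] V])
           (simp add: algebra_simps)
      then show "(S has_vector_derivative lam * (lam * V t)) (at t)" for t
        unfolding S_def by (rule has_vector_derivative_mult_right)
      show "((\<lambda>x. z x - V x + b x *\<^sub>R V x) \<longlongrightarrow> 0) F"
        using tendsto_add[OF tendsto_diff[OF z0 V0] bV] by simp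
      show "((\<lambda>x. lam * (lam * V x)) \<longlongrightarrow> 0) F"
        using tendsto_mult_left[OF tendsto_mult_left[OF V0]] by simp
      have "((\<lambda>x. 2 * lam * V x - lam * z x + b' x *\<^sub>R V x) \<longlongrightarrow> 2 * lam * 0 - lam * 0 + 0) F"
        by (intro tendsto_intros V0 z0 b'V)
      then show "((\<lambda>x. lam * (V x + W x) + b' x *\<^sub>R V x - S x) \<longlongrightarrow> 0) F"
        by (simp add: S_def algebra_simps)
    qed
    then have "((\<lambda>x. S x / lam - z x + V x) \<longlongrightarrow> 0 / lam - 0 + 0) F"
      using lam by (intro tendsto_intros V0 z0) auto
    then show ?thesis using lam by (simp add: S_def)
  qed
  \<comment> \<open>The first two terms come from testing with \<open>W / b\<close> and \<open>V\<close>; the last two are the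
    boundary terms of the coupling and of the viscous term. The real inner product of the complex
    plane takes the real part automatically.\<close>
  define E where "E = (\<lambda>x. (W x \<bullet> W x) / (2 * b x) + (V x \<bullet> V x) / 2 - W x \<bullet> V x - z x \<bullet> V x)"
  define E' where "E' = (\<lambda>x. - (Re lam * (W x \<bullet> W x) / b x) - Re lam * (V x \<bullet> V x)
        - b' x * (W x \<bullet> W x) / (2 * (b x)\<^sup>2) - c x * (z x \<bullet> z x))"
  have inner: "((\<lambda>x. f x \<bullet> g x) has_real_derivative (f x \<bullet> g' + f' \<bullet> g x)) (at x)"
    if "(f has_vector_derivative f') (at x)" "(g has_vector_derivative g') (at x)"
    for f g :: "real \<Rightarrow> complex" and f' g' x
    using bounded_bilinear.has_vector_derivative[OF bounded_bilinear_inner that]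
    by (simp add: has_real_derivative_iff_has_vector_derivative)
  have E: "(E has_real_derivative E' x) (at x)" for x
  proof -
    have b_nz: "b x \<noteq> 0" using b_pos[of x] by simp
    have lam_inner: "(lam * y) \<bullet> y = Re lam * (y \<bullet> y)" for y
      by (simp add: inner_complex_def algebra_simps)
    let ?W' = "(b x * c x) *\<^sub>R z x - lam * W x"
    have "?W' \<bullet> W x = b x * c x * (z x \<bullet> W x) - Re lam * (W x \<bullet> W x)"
      by (simp add: inner_diff_left lam_inner)
    then have "((W x \<bullet> ?W' + ?W' \<bullet> W x) * (2 * b x) - (W x \<bullet> W x) * (2 * b' x)) / ((2 * b x) * (2 * b x))
        = c x * (z x \<bullet> W x) - Re lam * (W x \<bullet> W x) / b x - b' x * (W x \<bullet> W x) / (2 * (b x)\<^sup>2)"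
      using b_nz by (simp add: inner_commute[of "W x" ?W'] power2_eq_square divide_simps)
    moreover have "((\<lambda>x. (W x \<bullet> W x) / (2 * b x)) has_real_derivative
        ((W x \<bullet> ?W' + ?W' \<bullet> W x) * (2 * b x) - (W x \<bullet> W x) * (2 * b' x)) / ((2 * b x) * (2 * b x))) (at x)"
      using b_nz by (intro DERIV_divide inner W DERIV_cmult b) auto
    ultimately have WW: "((\<lambda>x. (W x \<bullet> W x) / (2 * b x)) has_real_derivative
        c x * (z x \<bullet> W x) - Re lam * (W x \<bullet> W x) / b x - b' x * (W x \<bullet> W x) / (2 * (b x)\<^sup>2)) (at x)"
      by simp
    show ?thesis
      unfolding E_def
      by (rule DERIV_cong[OF DERIV_diff[OF DERIV_diff[OF DERIV_add[OF WW DERIV_cdivide[OF inner[OF V V]]]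
            inner[OF W V]] inner[OF z V]]])
         (simp add: E'_def inner_add_left inner_diff_left distrib_left lam_inner
           inner_commute[of "W x" "z x"] inner_commute[of "V x" "z x"] algebra_simps)
  qed
  have E'_le: "E' x \<le> - (c x * (z x \<bullet> z x))" for x
  proof -
    have "0 \<le> Re lam * (W x \<bullet> W x) / b x" "0 \<le> Re lam * (V x \<bullet> V x)"
      "0 \<le> b' x * (W x \<bullet> W x) / (2 * (b x)\<^sup>2)"
      using lam b_pos[of x] b'_nonneg[of x] by auto
    then show ?thesis by (simp add: E'_def)
  qed
  have E'_nonpos: "E' x \<le> 0" for x
    by (rule order_trans[OF E'_le]) (simp add: c_pos less_imp_le)
  have mono: "antimono E"
  proof (rule antimonoI)
    fix s t :: real assume "s \<le> t"
    then show "E t \<le> E s"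
      by (rule DERIV_nonpos_imp_nonincreasing) (intro exI conjI, rule E, rule E'_nonpos)
  qed
  have E0: "(E \<longlongrightarrow> 0) F"
    if F: "F = at_top \<or> F = at_bot" and V0: "(V \<longlongrightarrow> 0) F" and z0: "(z \<longlongrightarrow> 0) F" for F
  proof -
    note W0 = W0[OF F V0 z0]
    have "((\<lambda>x. (1 / (2 * b x)) *\<^sub>R W x) \<longlongrightarrow> 0) F"
      by (rule bnd[OF W0, where B="1 / (2 * b0)"])
         (use b_lower b_pos in \<open>auto simp: field_simps less_imp_le\<close>)
    from tendsto_inner[OF this W0]
    have "((\<lambda>x. (W x \<bullet> W x) / (2 * b x)) \<longlongrightarrow> 0) F" by simp
    then have "(E \<longlongrightarrow> 0 + (0 \<bullet> (0::complex)) / 2 - 0 \<bullet> (0::complex) - 0 \<bullet> (0::complex)) F"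
      unfolding E_def by (intro tendsto_diff tendsto_add tendsto_divide tendsto_inner V0 W0 z0) auto
    then show ?thesis by simp
  qed
  have "(E \<longlongrightarrow> 0) at_bot" "(E \<longlongrightarrow> 0) at_top"
    using E0 V_bot V_top z_bot z_top by blast+
  note antimono_between_limits[OF mono this]
  then have "E = (\<lambda>_. 0)" by (intro ext antisym) auto
  then have "(E has_real_derivative 0) (at x)" by simp
  then have "E' x = 0" by (rule DERIV_unique[OF E])
  then have "c x * (z x \<bullet> z x) \<le> 0" using E'_le[of x] by simp
  then have "z x \<bullet> z x \<le> 0" using c_pos[of x] by (simp add: mult_le_0_iff)
  then show "z x = 0" by (metis inner_eq_zero_iff inner_ge_zero order_antisym)
qed

section \<open>Stability of shock profiles\<close>

lemma pressure_coeff_pos: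
  assumes "\<gamma> > 0" "0 < vp" "vp < 1"
  shows "pressure_coeff \<gamma> vp > 0"
proof -
  have "vp powr \<gamma> < 1" using assms powr_less_mono2[of \<gamma> vp 1] by simp
  then show ?thesis using assms by (simp add: pressure_coeff_def)
qed

text \<open>It remains to pass to the effective variables. The eigenvalue equations say that
  \<open>\<lambda> v = (u - v)'\<close> and \<open>\<lambda> u = (p + q - u)'\<close> where \<open>p\<close> is the
  coefficient term of the second equation and \<open>q = u' / vhat\<close>, so antiderivatives of \<open>v\<close> and \<open>u\<close> can be read off without
  integrating; subtracting \<open>z = v / vhat\<close>, the linearisation of \<open>ln v\<close>, from the
  antiderivative of \<open>u\<close> gives that of the effective velocity.\<close>

theorem shock_profile_spectrally_stable:
  assumes g: "\<gamma> > 0" and vp: "0 < vp" "vp < 1" and prof: "shock_profile \<gamma> vp vhat uhat"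
  shows "spectrally_stable \<gamma> vp vhat"
  unfolding spectrally_stable_def
proof (safe)
  fix lam v u x
  assume lam: "lam \<noteq> 0" "Re lam \<ge> 0" and ev: "eigenvalue_solution \<gamma> vp vhat lam v u"
    and lim: "(v \<longlongrightarrow> 0) at_bot" "(v \<longlongrightarrow> 0) at_top" "(u \<longlongrightarrow> 0) at_bot" "(u \<longlongrightarrow> 0) at_top"
  define a where "a = pressure_coeff \<gamma> vp"
  have a_pos: "a > 0" using pressure_coeff_pos g vp by (simp add: a_def)
  \<comment> \<open>\<open>r\<close> is the logarithmic derivative of the profile.\<close>
  define r where "r = (\<lambda>x. vhat x - 1 + a * (vhat x powr (- \<gamma>) - 1))"
  have dv: "(vhat has_real_derivative vhat x * r x) (at x)" for x
    using prof by (simp add: shock_profile_def r_def a_def)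
  have anti: "antimono vhat" and vbot: "(vhat \<longlongrightarrow> 1) at_bot" and vtop: "(vhat \<longlongrightarrow> vp) at_top"
    using prof by (auto simp: shock_profile_def)
  note v_bounds = antimono_between_limits[OF anti vbot vtop]
  have v_pos: "vhat x > 0" for x using v_bounds(1)[of x] vp by linarith
  have r_nonpos: "r x \<le> 0" for x
  proof -
    have "vhat x * r x \<le> 0"
    proof (rule ccontr)
      assume "\<not> ?thesis"
      then obtain d where "d > 0" "\<And>h. h > 0 \<Longrightarrow> h < d \<Longrightarrow> vhat x < vhat (x + h)"
        using DERIV_pos_inc_right[OF dv, of x] by force
      then show False using anti[unfolded antimono_def, rule_format, of x "x + d/2"]
        by (force dest: spec[of _ "d/2"])
    qed
    then show ?thesis using v_pos[of x] by (simp add: mult_le_0_iff)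
  qed
  have r_ge: "- (1 + a) \<le> r x" for x
  proof -
    have "0 \<le> a * vhat x powr (- \<gamma>)" using a_pos by simp
    then show ?thesis using v_pos[of x] by (simp add: r_def algebra_simps)
  qed
  define b where "b = (\<lambda>x. a * \<gamma> * vhat x powr (- \<gamma> - 1))"
  define b' where "b' = (\<lambda>x. b x * ((\<gamma> + 1) * - r x))"
  have db: "(b has_real_derivative b' x) (at x)" for x
  proof -
    have "((\<lambda>x. vhat x powr (- \<gamma> - 1)) has_real_derivative
        (- \<gamma> - 1) * vhat x powr (- \<gamma> - 1 - 1) * (vhat x * r x)) (at x)"
      using has_real_derivative_powr[THEN DERIV_chain2, OF v_pos dv, of "- \<gamma> - 1"] by simp
    then have "(b has_real_derivative
        a * \<gamma> * ((- \<gamma> - 1) * vhat x powr (- \<gamma> - 1 - 1) * (vhat x * r x))) (at x)"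
      unfolding b_def by (rule DERIV_cmult)
    moreover have "vhat x powr (- \<gamma> - 1 - 1) * vhat x = vhat x powr (- \<gamma> - 1)"
    proof -
      have "vhat x powr ((- \<gamma> - 1 - 1) + 1) = vhat x powr (- \<gamma> - 1 - 1) * vhat x"
        using v_pos[of x] by (subst powr_add) simp
      moreover have "(- \<gamma> - 1 - 1) + 1 = - \<gamma> - 1" by simp
      ultimately show ?thesis by metis
    qed
    then have "b' x = a * \<gamma> * (vhat x powr (- \<gamma> - 1 - 1) * vhat x) * ((\<gamma> + 1) * - r x)"
      unfolding b'_def b_def by (rule arg_cong2[where f="(*)", OF arg_cong2[where f="(*)", OF refl sym] refl])
    then have "a * \<gamma> * ((- \<gamma> - 1) * vhat x powr (- \<gamma> - 1 - 1) * (vhat x * r x)) = b' x"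
      by (simp add: ring_distribs mult.assoc mult.left_commute)
    ultimately show ?thesis by simp
  qed
  define b1 where "b1 = a * \<gamma> * vp powr (- \<gamma> - 1)"
  have b_lower: "a * \<gamma> \<le> b x" for x
  proof -
    have "1 powr (- \<gamma> - 1) \<le> vhat x powr (- \<gamma> - 1)"
      using v_bounds v_pos g by (intro powr_mono2') auto
    then show ?thesis using a_pos g by (simp add: b_def)
  qed
  have b_upper: "b x \<le> b1" for x
    unfolding b_def b1_def using v_bounds v_pos g vp a_pos
    by (intro mult_left_mono powr_mono2') auto
  have b_pos: "b x > 0" for x using v_pos[of x] a_pos g by (simp add: b_def)
  have b'_nonneg: "b' x \<ge> 0" for x 
    unfolding b'_def using b_pos[of x] r_nonpos[of x] g by (intro mult_nonneg_nonneg) auto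
  have b'_upper: "b' x \<le> b1 * ((\<gamma> + 1) * (1 + a))" for x
    unfolding b'_def using b_pos[of x] b_upper[of x] r_nonpos[of x] r_ge[of x] g
    by (intro mult_mono) (auto simp: mult_le_0_iff)
  obtain v' u' p' q' where eq:
      "\<And>x. (v has_vector_derivative v' x) (at x)"
      "\<And>x. (u has_vector_derivative u' x) (at x)"
      "\<And>x. ((\<lambda>y. complex_of_real (h_coeff \<gamma> vp (vhat y) / vhat y powr (\<gamma> + 1)) * v y)
           has_vector_derivative p' x) (at x)"
      "\<And>x. ((\<lambda>y. u' y / complex_of_real (vhat y)) has_vector_derivative q' x) (at x)"
      "\<And>x. lam * v x + v' x - u' x = 0"
      "\<And>x. lam * u x + u' x - p' x = q' x"
    using ev unfolding eigenvalue_solution_def by - (elim exE, rule that, blast+)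
  define p where "p = (\<lambda>y. (b y - r y / vhat y) *\<^sub>R v y)"
  define q where "q = (\<lambda>y. (1 / vhat y) *\<^sub>R u' y)"
  \<comment> \<open>The coefficient in the eigenvalue problem is minus the pressure derivative, corrected by
    the linearisation of the viscosity \<open>1 / v\<close>.\<close>
  have h: "h_coeff \<gamma> vp (vhat y) / vhat y powr (\<gamma> + 1) = b y - r y / vhat y" for y
  proof -
    have "vhat y powr (- \<gamma> - 1) = 1 / (vhat y powr \<gamma> * vhat y)"
      "vhat y powr (- \<gamma>) = 1 / vhat y powr \<gamma>" "vhat y powr (\<gamma> + 1) = vhat y powr \<gamma> * vhat y"
      using v_pos[of y] powr_minus_divide[of "vhat y" "\<gamma> + 1"] powr_minus_divide[of "vhat y" \<gamma>]
      by (auto simp: powr_add)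
    then show ?thesis using v_pos[of y]
      by (simp add: h_coeff_def b_def r_def a_def[symmetric] field_simps)
  qed
  have dp: "(p has_vector_derivative p' x) (at x)" for x
    using eq(3)[of x] unfolding h p_def by (simp add: scaleR_conv_of_real)
  have dq: "(q has_vector_derivative q' x) (at x)" for x
    using eq(4)[of x] unfolding q_def by (simp add: scaleR_conv_of_real divide_inverse mult.commute)
  define z where "z = (\<lambda>y. (1 / vhat y) *\<^sub>R v y)"
  define z' where "z' = (\<lambda>y. (1 / vhat y) *\<^sub>R v' y - (r y / vhat y) *\<^sub>R v y)"
  define V where "V = (\<lambda>y. (u y - v y) / lam)"
  define W where "W = (\<lambda>y. (p y + q y - u y) / lam - z y)"
  have vz: "v y = vhat y *\<^sub>R z y" for y using v_pos[of y] by (simp add: z_def)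
  have lamV: "lam * V y = u y - v y" for y using lam by (simp add: V_def)
  have lamW: "lam * W y = b y *\<^sub>R v y + z' y - u y" for y
  proof -
    have "u' y = lam * v y + v' y" using eq(5)[of y] by (simp add: algebra_simps)
    then have "p y + q y = b y *\<^sub>R v y + z' y + lam * z y"
      by (simp add: p_def q_def z_def z'_def scaleR_left_diff_distrib scaleR_right_distrib)
    moreover have "lam * W y = p y + q y - u y - lam * z y"
      using lam by (simp add: W_def right_diff_distrib[of lam _ "z y"])
    ultimately show ?thesis by simp
  qed
  have dz: "(z has_vector_derivative z' x) (at x)" for x
  proof -
    have "((\<lambda>y. 1 / vhat y) has_real_derivative - (r x / vhat x)) (at x)"
      using v_pos[of x] by (auto intro!: derivative_eq_intros dv simp: power2_eq_square)
    from has_vector_derivative_scaleR[OF this eq(1)[of x]]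
    show ?thesis unfolding z_def z'_def by simp
  qed
  have dV: "(V has_vector_derivative v x) (at x)" for x
  proof -
    have "(V has_vector_derivative (u' x - v' x) / lam) (at x)"
      unfolding V_def by (intro has_vector_derivative_divide has_vector_derivative_diff eq)
    moreover have "(u' x - v' x) / lam = v x"
      using eq(5)[of x] lam by (simp add: field_simps)
    ultimately show ?thesis by simp
  qed
  have V_lim: "(V \<longlongrightarrow> 0) at_bot" "(V \<longlongrightarrow> 0) at_top"
    unfolding V_def using lim lam by (auto intro!: tendsto_eq_intros)
  have "z y = 0" for y
  proof (rule effective_system_trivial[OF lam])
    show "(V has_vector_derivative vhat x *\<^sub>R z x) (at x)" for x
      using dV[of x] by (simp add: vz)
    show "(W has_vector_derivative (b x * vhat x) *\<^sub>R z x - lam * W x) (at x)" for x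
    proof -
      have "(W has_vector_derivative (p' x + q' x - u' x) / lam - z' x) (at x)"
        unfolding W_def by (intro has_vector_derivative_divide has_vector_derivative_diff
          has_vector_derivative_add dp dq dz eq)
      moreover have "(p' x + q' x - u' x) / lam = u x"
        using eq(6)[of x] lam by (simp add: field_simps)
      ultimately show ?thesis by (simp add: lamW vz)
    qed
    show "(z has_vector_derivative lam * (V x + W x) + ((1 - b x) * vhat x) *\<^sub>R z x) (at x)" for x
      using dz[of x] by (simp add: distrib_left lamV lamW vz algebra_simps)
    show "(b has_real_derivative b' x) (at x)" for x by (rule db)
    show "a * \<gamma> > 0" using a_pos g by simp
    show "(V \<longlongrightarrow> 0) at_bot" "(V \<longlongrightarrow> 0) at_top" by (fact V_lim)+
    show "(z \<longlongrightarrow> 0) at_bot" "(z \<longlongrightarrow> 0) at_top"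
      unfolding z_def using lim vbot vtop vp by (auto intro!: tendsto_eq_intros)
  qed (fact v_pos b_lower b'_nonneg b_upper b'_upper)+
  then have v0: "v y = 0" for y by (simp add: vz)
  have V0: "V y = 0" for y
  proof -
    have "(V has_vector_derivative 0) (at x within UNIV)" for x
      using dV[of x] by (simp add: v0)
    then obtain k where k: "\<And>x. V x = k"
      using has_vector_derivative_zero_constant[of UNIV V] by auto
    then have "V = (\<lambda>_. k)" by blast
    then have "k = 0" using V_lim(2) by (simp add: tendsto_const_iff)
    then show ?thesis using k by simp
  qed
  have u0: "u y = 0" for y using lamV[of y] V0 v0 by simp
  show "v x \<noteq> 0 \<Longrightarrow> False" using v0 by simp
  show "u x \<noteq> 0 \<Longrightarrow> False" using u0 by simp
qed

theorem corollary3: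
  fixes \<gamma> :: real
  assumes "\<gamma> \<ge> 1"
  shows "(\<exists>vstar. 0 < vstar \<and> vstar < 1 \<and>
            (\<forall>vp vhat uhat. 0 < vp \<and> vp < vstar \<and> shock_profile \<gamma> vp vhat uhat
               \<longrightarrow> spectrally_stable \<gamma> vp vhat)) \<and>
         (\<exists>Mstar. \<forall>vp vhat uhat. 0 < vp \<and> vp < 1 \<and> Mstar < mach_number \<gamma> vp \<and>
               shock_profile \<gamma> vp vhat uhat
               \<longrightarrow> spectrally_stable \<gamma> vp vhat)"
proof -
  have stable: "spectrally_stable \<gamma> vp vhat"
    if "0 < vp" "vp < 1" "shock_profile \<gamma> vp vhat uhat" for vp vhat uhat
    using shock_profile_spectrally_stable[OF _ that] assms by simp
  have "0 < (1/2::real) \<and> (1/2::real) < 1 \<and>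
      (\<forall>vp vhat uhat. 0 < vp \<and> vp < 1/2 \<and> shock_profile \<gamma> vp vhat uhat
        \<longrightarrow> spectrally_stable \<gamma> vp vhat)"
    using stable by fastforce
  moreover have "\<forall>vp vhat uhat. 0 < vp \<and> vp < 1 \<and> 0 < mach_number \<gamma> vp \<and>
      shock_profile \<gamma> vp vhat uhat \<longrightarrow> spectrally_stable \<gamma> vp vhat"
    using stable by blast
  ultimately show ?thesis by blast
qed

end
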